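(* Consider an Erd\H{o}s--R\'enyi random graph $G_{n,p}$ with $p\ge 7\left(\frac{\gamma\ln n}{n}\right)^{1/7}$ for some $\gamma>3$, labelled uniformly at random from $\{1,2,\ldots,\alpha\}$, where $\alpha\ge 4$. Then any instance $I$ of $G_{n,p}$ needs only $\Theta(n+np^5)$ time-edges to be temporally connected, with probability at least $1-2e^{-\gamma'\ln n}$, for some $\gamma'\ge 1$; that is, with at least this probability all but $\Theta(n+np^5)$ of the labels of the labelled instance can be removed so that the remaining temporal graph is temporally connected.
   Context: $G_{n,p}$: each of the $\binom n2$ possible edges on $n$ vertices is present independently with probability $p$. "Labelled uniformly at random" means that each existing edge receives exactly one label chosen uniformly at random from $\{1,2,\ldots,\alpha\}$, independently of the labels of other edges and of the choice of edges of $G_{n,p}$. A $(u,v)$-journey is a path from $u$ to $v$ whose successive edges carry strictly increasing labels. A labelled graph is temporally connected (satisfies TC) if for every ordered pair of distinct vertices $u,v$ there is a $(u,v)$-journey. A time-edge here means an edge together with its label. *)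

theory Defs
  imports "HOL-Probability.Probability" "HOL-Probability.Product_PMF"
begin

text \<open>
  The vertex set is \<open>{..<n}\<close>; an edge is a two-element set of vertices. A temporal graph is
  represented by its set of time-edges, so removing labels means passing to a subset and the
  number of time-edges is the cardinality.
\<close>

type_synonym edge = "nat set"
type_synonym time_edge = "edge \<times> nat"

definition possible_edges :: "nat \<Rightarrow> edge set" where
  "possible_edges n = {e. e \<subseteq> {..<n} \<and> card e = 2}"

text \<open>
  A journey visits the vertices \<open>xs\<close>, which are pairwise distinct, and uses the label \<open>ts ! i\<close>
  on its \<open>i\<close>-th edge.
\<close>

definition journey :: "time_edge set \<Rightarrow> nat \<Rightarrow> nat \<Rightarrow> nat list \<Rightarrow> nat list \<Rightarrow> bool" where
  "journey T u v xs ts \<longleftrightarrow>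
     length xs = Suc (length ts) \<and> distinct xs \<and> hd xs = u \<and> last xs = v \<and>
     (\<forall>i<length ts. ({xs ! i, xs ! Suc i}, ts ! i) \<in> T) \<and>
     sorted_wrt (<) ts"

definition temporally_connected :: "nat \<Rightarrow> time_edge set \<Rightarrow> bool" where
  "temporally_connected n T \<longleftrightarrow>
     (\<forall>u<n. \<forall>v<n. u \<noteq> v \<longrightarrow> (\<exists>xs ts. journey T u v xs ts))"

definition gnp :: "nat \<Rightarrow> real \<Rightarrow> edge set pmf" where
  "gnp n p =
     map_pmf (\<lambda>f. {e \<in> possible_edges n. f e})
       (Pi_pmf (possible_edges n) False (\<lambda>_. bernoulli_pmf p))"

text \<open>
  Given the random edge set \<open>E\<close>, the labels of the edges in \<open>E\<close> are independent and uniform; the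
  value 0 of \<open>l\<close> outside \<open>E\<close> is never used.
\<close>

definition labelled_gnp :: "nat \<Rightarrow> real \<Rightarrow> nat \<Rightarrow> time_edge set pmf" where
  "labelled_gnp n p \<alpha> =
     bind_pmf (gnp n p) (\<lambda>E.
       map_pmf (\<lambda>l. (\<lambda>e. (e, l e)) ` E)
         (Pi_pmf E 0 (\<lambda>_. pmf_of_set {1..\<alpha>})))"

end

theory Submission imports Defs
begin

text \<open>
  Split the labels \<open>1..4k\<close>, where \<open>k = \<alpha> div 4\<close>, into four consecutive blocks of length \<open>k\<close>.
  A given pair of vertices is an edge with label in a given block with probability at least
  \<open>q = p / 7\<close>. Fix about \<open>sqrt n\<close> vertices as hubs. With high probability every other
  vertex has an edge with label in block 0 and one with label in block 3 to some hub, and any two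
  distinct hubs \<open>a\<close>, \<open>b\<close> have a non-hub \<open>w\<close> such that \<open>aw\<close> has its label in block 1 and \<open>wb\<close>
  its label in block 2. Keeping one such edge or pair of edges for every requirement leaves at
  most \<open>4n\<close> time-edges, through which every vertex reaches every other one. As \<open>p \<le> 1\<close>, the
  order of magnitude \<open>n + n p ^ 5\<close> is just \<open>n\<close>, and the lower bound holds because no vertex is
  isolated.
\<close>

subsection \<open>Journeys\<close>

text \<open>The strict bound \<open>t\<close> records after which time a journey starts, so that
  legs using later and later blocks of labels can be joined.\<close>

definition reach :: "time_edge set \<Rightarrow> nat \<Rightarrow> nat \<Rightarrow> nat \<Rightarrow> bool" where
  "reach T t u v \<longleftrightarrow> (\<exists>xs ts. journey T u v xs ts \<and> (\<forall>s\<in>set ts. t < s))"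

lemma reach_refl: "reach T t u u"
  unfolding reach_def journey_def by (rule exI[of _ "[u]"], rule exI[of _ "[]"]) simp

lemma reach_mono: "reach T s u v \<Longrightarrow> t \<le> s \<Longrightarrow> reach T t u v"
  unfolding reach_def by (meson le_less_trans)

text \<open>A journey must not repeat a vertex. If \<open>x\<close> already lies on the journey from
  \<open>y\<close>, the part from \<open>x\<close> onwards serves by itself, its labels being above
  \<open>s\<close> and hence above \<open>t\<close>; otherwise the new edge is put in front.\<close>

lemma reach_step:
  assumes e: "({x, y}, s) \<in> T" and ts: "t < s" and r: "reach T s y v"
  shows "reach T t x v"
proof -
  obtain xs ls where j: "journey T y v xs ls" and gt: "\<forall>l\<in>set ls. s < l"
    using r unfolding reach_def by blast
  from j have len: "length xs = Suc (length ls)" and dist: "distinct xs" and hd: "hd xs = y"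
    and last: "last xs = v" and sorted: "sorted_wrt (<) ls"
    and edges: "\<And>i. i < length ls \<Longrightarrow> ({xs ! i, xs ! Suc i}, ls ! i) \<in> T"
    unfolding journey_def by auto
  show ?thesis
  proof (cases "x \<in> set xs")
    case True
    then obtain i where i: "i < length xs" "xs ! i = x"
      by (auto simp: in_set_conv_nth)
    have "journey T x v (drop i xs) (drop i ls)"
      unfolding journey_def using i len dist last sorted edges
      by (auto simp: hd_drop_conv_nth sorted_wrt_drop add.commute)
    moreover have "\<forall>l\<in>set (drop i ls). t < l"
      using gt ts by (meson in_set_dropD less_trans)
    ultimately show ?thesis unfolding reach_def by blast
  next
    case False
    have y: "xs ! 0 = y"
      using len hd by (cases xs) auto
    have "journey T x v (x # xs) (s # ls)"
      unfolding journey_def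
    proof (intro conjI allI impI)
      fix i assume "i < length (s # ls)"
      then show "({(x # xs) ! i, (x # xs) ! Suc i}, (s # ls) ! i) \<in> T"
        using e y edges by (cases i) auto
    qed (use len dist last sorted gt False in \<open>auto split: if_splits\<close>)
    moreover have "\<forall>l\<in>set (s # ls). t < l"
      using gt ts by auto
    ultimately show ?thesis unfolding reach_def by blast
  qed
qed

lemma temporally_connected_reachI:
  assumes "\<And>u v. u < n \<Longrightarrow> v < n \<Longrightarrow> reach T 0 u v"
  shows "temporally_connected n T"
  unfolding temporally_connected_def using assms unfolding reach_def by blast

section \<open>Label functions and the lower bound on the number of time-edges\<close>

text \<open>One function on the possible edges encodes both the edge set and the labels, with 0 for
  an absent edge. The random temporal graph thus becomes the image of a product measure.\<close>

definition time_edges :: "nat \<Rightarrow> (edge \<Rightarrow> nat) \<Rightarrow> time_edge set" where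
  "time_edges n f = (\<lambda>e. (e, f e)) ` {e \<in> possible_edges n. f e \<noteq> 0}"

lemma finite_possible_edges: "finite (possible_edges n)"
  unfolding possible_edges_def by (rule finite_subset[of _ "Pow {..<n}"]) auto

lemma finite_time_edges: "finite (time_edges n f)"
  unfolding time_edges_def using finite_possible_edges by simp

lemma pair_in_possible_edges:
  "{a, b} \<in> possible_edges n \<longleftrightarrow> a < n \<and> b < n \<and> a \<noteq> b"
  unfolding possible_edges_def by (auto simp: card_2_iff doubleton_eq_iff)

text \<open>No vertex is isolated, because a journey to some other vertex starts with a time-edge at
  it, and each time-edge covers only two vertices.\<close>

lemma temporally_connected_card_ge:
  assumes n: "n \<ge> 2" and S: "S \<subseteq> time_edges n f" and tc: "temporally_connected n S"
  shows "n \<le> 2 * card S"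
proof -
  have fin: "finite S"
    using S finite_time_edges finite_subset by blast
  have card2: "card e = 2" if "(e, t) \<in> S" for e t
    using S that unfolding time_edges_def possible_edges_def by auto
  have "{..<n} \<subseteq> (\<Union>x\<in>S. fst x)"
  proof
    fix u assume u: "u \<in> {..<n}"
    define v where "v = (if u = 0 then 1 else 0 :: nat)"
    have v: "v < n" "u \<noteq> v"
      using n by (auto simp: v_def)
    then obtain xs ts where j: "journey S u v xs ts"
      using tc u unfolding temporally_connected_def by blast
    have "ts \<noteq> []"
    proof
      assume "ts = []"
      then show False
        using j v(2) unfolding journey_def by (auto simp: length_Suc_conv)
    qed
    then have "({xs ! 0, xs ! Suc 0}, ts ! 0) \<in> S" "length xs \<noteq> 0" "hd xs = u"
      using j unfolding journey_def by auto
    moreover have "xs ! 0 = u"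
      using calculation by (cases xs) auto
    ultimately show "u \<in> (\<Union>x\<in>S. fst x)"
      by force
  qed
  then have "n \<le> card (\<Union>x\<in>S. fst x)"
    using card_mono[of "\<Union>x\<in>S. fst x" "{..<n}"] fin card2
    by (metis (no_types, lifting) card.infinite card_lessThan finite_UN_I prod.collapse zero_neq_numeral)
  also have "\<dots> \<le> (\<Sum>x\<in>S. card (fst x))"
    using fin by (rule card_UN_le)
  also have "\<dots> = (\<Sum>x\<in>S. 2)"
    using card2 by (intro sum.cong) auto
  finally show ?thesis by simp
qed

section \<open>The deterministic spanner through the hubs\<close>

text \<open>Starting at \<open>i * k + 1\<close> keeps the label 0 of absent edges out of every
  block and puts all labels of block \<open>i\<close> strictly above \<open>i * k\<close>, as
  \<open>reach\<close> requires.\<close>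

definition label_block :: "nat \<Rightarrow> nat \<Rightarrow> nat set" where
  "label_block k i = {i * k + 1..(i + 1) * k}"

text \<open>Between non-hubs, the route is \<open>u\<close>, \<open>A u\<close>,
  \<open>W (A u) (B v)\<close>, \<open>B v\<close>, \<open>v\<close>, with labels in blocks 0, 1, 2,
  3. Endpoints that are hubs, or equal hubs, merely drop legs, and other coincidences of vertices
  are absorbed by \<open>reach_step\<close>. Each non-hub costs two time-edges, and so does each
  ordered pair of hubs.\<close>

lemma hub_spanner:
  assumes H: "H \<subseteq> {..<n}"
    and into: "\<And>u. u \<in> {..<n} - H \<Longrightarrow> \<exists>a\<in>H. f {u, a} \<in> label_block k 0"
    and mid: "\<And>a b. a \<in> H \<Longrightarrow> b \<in> H \<Longrightarrow> a \<noteq> b \<Longrightarrow>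
      \<exists>w\<in>{..<n} - H. f {a, w} \<in> label_block k 1 \<and> f {w, b} \<in> label_block k 2"
    and out: "\<And>v. v \<in> {..<n} - H \<Longrightarrow> \<exists>b\<in>H. f {b, v} \<in> label_block k 3"
  shows "\<exists>S\<subseteq>time_edges n f. temporally_connected n S \<and> card S \<le> 2 * n + 2 * (card H)\<^sup>2"
proof -
  have finH: "finite H"
    using H finite_subset by blast
  obtain A where A: "\<And>u. u \<in> {..<n} - H \<Longrightarrow> A u \<in> H \<and> f {u, A u} \<in> label_block k 0"
    using into by metis
  obtain B where B: "\<And>v. v \<in> {..<n} - H \<Longrightarrow> B v \<in> H \<and> f {B v, v} \<in> label_block k 3"
    using out by metis
  obtain W where W: "\<And>a b. a \<in> H \<Longrightarrow> b \<in> H \<Longrightarrow> a \<noteq> b \<Longrightarrow> W a b \<in> {..<n} - H \<and>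
      f {a, W a b} \<in> label_block k 1 \<and> f {W a b, b} \<in> label_block k 2"
    using mid by metis
  define te where "te = (\<lambda>e. (e, f e))"
  \<comment> \<open>The pairs are ordered because the edge at the first hub needs block 1 and the
    edge at the second needs block 2.\<close>
  define P where "P = {(a, b). a \<in> H \<and> b \<in> H \<and> a \<noteq> b}"
  define S1 where "S1 = (\<lambda>u. te {u, A u}) ` ({..<n} - H)"
  define S2 where "S2 = (\<lambda>(a, b). te {a, W a b}) ` P"
  define S3 where "S3 = (\<lambda>(a, b). te {W a b, b}) ` P"
  define S4 where "S4 = (\<lambda>v. te {B v, v}) ` ({..<n} - H)"
  define S where "S = S1 \<union> S2 \<union> S3 \<union> S4"
  have P: "P \<subseteq> H \<times> H"
    by (auto simp: P_def)
  have te_in: "te {x, y} \<in> time_edges n f"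
    if "x < n" "y < n" "x \<noteq> y" "f {x, y} \<in> label_block k i" for x y i
    using that by (auto simp: te_def time_edges_def pair_in_possible_edges label_block_def)
  have sub: "S \<subseteq> time_edges n f"
    unfolding S_def S1_def S2_def S3_def S4_def P_def
    using A B W H by (fastforce intro: te_in)
  have "card P \<le> (card H)\<^sup>2"
    using card_mono[OF _ P] finH by (simp add: card_cartesian_product power2_eq_square)
  moreover have finP: "finite P"
    using P finH finite_subset by blast
  ultimately have "card S2 \<le> (card H)\<^sup>2" "card S3 \<le> (card H)\<^sup>2"
    unfolding S2_def S3_def using card_image_le[OF finP] le_trans by blast+
  moreover have V: "card ({..<n} - H) \<le> n"
    using card_mono[OF finite_lessThan Diff_subset[of "{..<n}" H]] by simp
  moreover have "card S1 \<le> n" "card S4 \<le> n"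
    unfolding S1_def S4_def by (rule order_trans[OF card_image_le V]; simp)+
  moreover have "card S \<le> card S1 + card S2 + card S3 + card S4"
    unfolding S_def using card_Un_le[of "S1 \<union> S2 \<union> S3" S4] card_Un_le[of "S1 \<union> S2" S3]
      card_Un_le[of S1 S2] by linarith
  ultimately have card: "card S \<le> 2 * n + 2 * (card H)\<^sup>2"
    by linarith
  \<comment> \<open>The legs are built backwards from the end, as \<open>reach_step\<close> adds an
    edge in front. The bounds \<open>3 * k\<close>, \<open>k\<close> and 0 lie just below blocks 3,
    1 and 0.\<close>
  have fin_leg: "reach S (3 * k) b v" if "v < n" "b = (if v \<in> H then v else B v)" for b v
  proof (cases "v \<in> H")
    case False
    have "({b, v}, f {b, v}) \<in> S" "f {b, v} \<in> label_block k 3"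
      using that False B[of v] by (auto simp: S_def S4_def te_def)
    then show ?thesis
      by (intro reach_step[OF _ _ reach_refl]) (auto simp: label_block_def)
  qed (use that reach_refl in auto)
  have hub_leg: "reach S k a v" if a: "a \<in> H" and v: "v < n" for a v
  proof -
    define b where "b = (if v \<in> H then v else B v)"
    have b: "b \<in> H" "reach S (3 * k) b v"
      using v B[of v] fin_leg[OF v b_def] by (auto simp: b_def)
    show ?thesis
    proof (cases "a = b")
      case True
      then show ?thesis using b reach_mono by fastforce
    next
      case False
      define w where "w = W a b"
      have w: "f {a, w} \<in> label_block k 1" "f {w, b} \<in> label_block k 2"
        using W[OF a b(1) False] by (auto simp: w_def)
      have P': "(a, b) \<in> P"
        using a b False by (auto simp: P_def)
      have "te {a, w} \<in> S2" "te {w, b} \<in> S3"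
        unfolding S2_def S3_def w_def using P' by force+
      then have in_S: "({a, w}, f {a, w}) \<in> S" "({w, b}, f {w, b}) \<in> S"
        by (auto simp: S_def te_def)
      have "reach S (2 * k) w v"
        by (rule reach_step[OF in_S(2) _ reach_mono[OF b(2)]])
          (use w in \<open>auto simp: label_block_def\<close>)
      then show ?thesis
        by (intro reach_step[OF in_S(1) _ reach_mono[of S "2 * k"]])
          (use w in \<open>auto simp: label_block_def\<close>)
    qed
  qed
  have "reach S 0 u v" if u: "u < n" and v: "v < n" for u v
  proof (cases "u \<in> H")
    case True
    then show ?thesis using hub_leg v reach_mono by blast
  next
    case False
    have "({u, A u}, f {u, A u}) \<in> S" "f {u, A u} \<in> label_block k 0" "A u \<in> H"
      using u False A[of u] by (auto simp: S_def S1_def te_def)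
    then show ?thesis
      by (intro reach_step[OF _ _ reach_mono[OF hub_leg[of "A u" v]]] v)
        (auto simp: label_block_def)
  qed
  then show ?thesis
    using sub card temporally_connected_reachI by blast
qed

subsection \<open>The random labels\<close>

text \<open>The label 0 encodes an absent edge.\<close>

definition label_pmf :: "real \<Rightarrow> nat \<Rightarrow> nat pmf" where
  "label_pmf p \<alpha> =
     bind_pmf (bernoulli_pmf p) (\<lambda>b. if b then pmf_of_set {1..\<alpha>} else return_pmf 0)"

definition labels_pmf :: "nat \<Rightarrow> real \<Rightarrow> nat \<Rightarrow> (edge \<Rightarrow> nat) pmf" where
  "labels_pmf n p \<alpha> = Pi_pmf (possible_edges n) 0 (\<lambda>_. label_pmf p \<alpha>)"

text \<open>Drawing all edges and then their labels amounts to drawing presence and label together,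
  independently for each possible edge. This replaces the two-stage experiment by a single product
  measure.\<close>

lemma labelled_gnp_eq_map:
  assumes \<alpha>: "\<alpha> \<ge> 1"
  shows "labelled_gnp n p \<alpha> = map_pmf (time_edges n) (labels_pmf n p \<alpha>)"
proof -
  let ?A = "possible_edges n" and ?U = "pmf_of_set {1..\<alpha>}"
  let ?B = "Pi_pmf ?A False (\<lambda>_. bernoulli_pmf p)"
  let ?E = "\<lambda>g. {e \<in> ?A. g e}"
  have "labels_pmf n p \<alpha> = bind_pmf ?B (\<lambda>g. Pi_pmf ?A 0 (\<lambda>e. if g e then ?U else return_pmf 0))"
    unfolding labels_pmf_def label_pmf_def by (rule Pi_pmf_bind[OF finite_possible_edges])
  also have "\<dots> = bind_pmf ?B (\<lambda>g. Pi_pmf (?E g) 0 (\<lambda>e. if g e then ?U else return_pmf 0))"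
    by (intro bind_pmf_cong refl Pi_pmf_subset') (auto simp: finite_possible_edges)
  also have "\<dots> = bind_pmf ?B (\<lambda>g. Pi_pmf (?E g) 0 (\<lambda>_. ?U))"
    by (intro bind_pmf_cong refl Pi_pmf_cong) auto
  finally have labels: "labels_pmf n p \<alpha> = bind_pmf ?B (\<lambda>g. Pi_pmf (?E g) 0 (\<lambda>_. ?U))" .
  \<comment> \<open>Labels of present edges are at least 1, so the support of \<open>l\<close>
    recovers exactly the drawn edge set.\<close>
  have image: "time_edges n l = (\<lambda>e. (e, l e)) ` ?E g"
    if "l \<in> set_pmf (Pi_pmf (?E g) 0 (\<lambda>_. ?U))" for g l
  proof -
    have "l \<in> PiE_dflt (?E g) 0 (set_pmf \<circ> (\<lambda>_. ?U))"
      using that finite_possible_edges by (subst (asm) set_Pi_pmf) auto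
    then have "{e \<in> ?A. l e \<noteq> 0} = ?E g"
      using \<alpha> by (force simp: PiE_dflt_def set_pmf_of_set)
    then show ?thesis
      by (simp add: time_edges_def)
  qed
  have "labelled_gnp n p \<alpha> =
      bind_pmf ?B (\<lambda>g. map_pmf (\<lambda>l. (\<lambda>e. (e, l e)) ` ?E g) (Pi_pmf (?E g) 0 (\<lambda>_. ?U)))"
    unfolding labelled_gnp_def gnp_def by (simp add: bind_map_pmf)
  also have "\<dots> = bind_pmf ?B (\<lambda>g. map_pmf (time_edges n) (Pi_pmf (?E g) 0 (\<lambda>_. ?U)))"
    by (intro bind_pmf_cong refl map_pmf_cong) (simp add: image)
  finally show ?thesis
    by (simp add: labels map_bind_pmf)
qed

text \<open>A block holds \<open>k\<close> of the \<alpha> labels, and \<alpha> \<le> 4k + 3 \<le>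
  7k because k \<ge> 1. The worst case is \<alpha> = 7, which is where the 7 in \<open>p / 7\<close>
  comes from.\<close>

lemma prob_label_block:
  assumes p: "0 \<le> p" "p \<le> 1" and \<alpha>: "\<alpha> \<ge> 4" and i: "i < 4"
  shows "measure_pmf.prob (label_pmf p \<alpha>) (label_block (\<alpha> div 4) i) \<ge> p / 7"
proof -
  define k where "k = \<alpha> div 4"
  have k: "4 * k \<le> \<alpha>" "\<alpha> \<le> 7 * k"
    using \<alpha> unfolding k_def by presburger+
  have "(i + 1) * k \<le> 4 * k"
    using i by (intro mult_right_mono) auto
  then have "(i + 1) * k \<le> \<alpha>"
    using k by linarith
  then have "label_block k i \<subseteq> {1..\<alpha>}"
    by (auto simp: label_block_def)
  then have "pmf (label_pmf p \<alpha>) x = p / real \<alpha>" if "x \<in> label_block k i" for x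
    using that p \<alpha> by (auto simp: label_pmf_def pmf_bind label_block_def indicator_def)
  then have "measure_pmf.prob (label_pmf p \<alpha>) (label_block k i) = p * (real k / real \<alpha>)"
    by (simp add: measure_measure_pmf_finite label_block_def)
  also have "\<dots> \<ge> p * (1 / 7)"
    using k \<alpha> p by (intro mult_left_mono) (auto simp: field_simps)
  finally show ?thesis
    by (simp add: k_def)
qed

section \<open>Independence over disjoint sets of coordinates\<close>

text \<open>Restrictions of a random function to disjoint sets \<open>J w\<close> are independent,
  and by \<open>dep\<close> each \<open>Q w\<close> is a function of the restriction to
  \<open>J w\<close>.\<close>

lemma prob_Pi_pmf_blocks:
  fixes d :: "'b :: countable"
  assumes A: "finite A" and W: "finite W" and J: "\<And>w. w \<in> W \<Longrightarrow> J w \<subseteq> A"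
    and disj: "disjoint_family_on J W"
    and dep: "\<And>w f g. w \<in> W \<Longrightarrow> (\<And>x. x \<in> J w \<Longrightarrow> f x = g x) \<Longrightarrow> Q w f = Q w g"
  shows "measure_pmf.prob (Pi_pmf A d p) {f. \<forall>w\<in>W. Q w f} =
    (\<Prod>w\<in>W. measure_pmf.prob (Pi_pmf A d p) {f. Q w f})"
proof (cases "W = {}")
  case False
  let ?M = "measure_pmf (Pi_pmf A d p)"
  have "prob_space.indep_vars ?M (\<lambda>w. PiM (J w) (\<lambda>_. count_space UNIV)) (\<lambda>w f. restrict f (J w)) W"
    using prob_space.indep_vars_restrict[OF measure_pmf.prob_space_axioms indep_vars_Pi_pmf[OF A] J disj] by simp
  then have "prob_space.indep_vars ?M (\<lambda>_. count_space UNIV) (\<lambda>w f. Q w (restrict f (J w))) W"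
  proof (rule prob_space.indep_vars_compose2[OF measure_pmf.prob_space_axioms])
    fix w assume "w \<in> W"
    then have "finite (J w)"
      using J A finite_subset by blast
    \<comment> \<open>A finite product of countable discrete spaces is discrete, so every predicate
      is measurable; this is why the values have a countable type.\<close>
    then show "Q w \<in> measurable (PiM (J w) (\<lambda>_. count_space UNIV)) (count_space UNIV)"
      by (simp add: count_space_PiM_finite)
  qed
  then have "measure_pmf.prob (Pi_pmf A d p) (\<Inter>w\<in>W. (\<lambda>f. Q w (restrict f (J w))) -` {True} \<inter> space ?M) =
      (\<Prod>w\<in>W. measure_pmf.prob (Pi_pmf A d p) ((\<lambda>f. Q w (restrict f (J w))) -` {True} \<inter> space ?M))"
    using W False by (intro prob_space.indep_varsD_finite[OF measure_pmf.prob_space_axioms]) auto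
  moreover have "Q w (restrict f (J w)) = Q w f" if "w \<in> W" for w f
    using that by (intro dep) auto
  then have "(\<lambda>f. Q w (restrict f (J w))) -` {True} = {f. Q w f}" if "w \<in> W" for w
    using that by auto
  ultimately have "measure_pmf.prob (Pi_pmf A d p) (\<Inter>w\<in>W. {f. Q w f}) = (\<Prod>w\<in>W. measure_pmf.prob (Pi_pmf A d p) {f. Q w f})"
    by simp
  moreover have "(\<Inter>w\<in>W. {f. Q w f}) = {f. \<forall>w\<in>W. Q w f}"
    by blast
  ultimately show ?thesis by simp
qed simp

text \<open>Independence is used twice: among the \<open>m\<close> coordinates of one block, which
  all succeed with probability at least \<open>q ^ m\<close>, and among the blocks. The case
  \<open>m = 1\<close> serves edges from a vertex to the hubs, \<open>m = 2\<close> two-edge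
  connections between hubs.\<close>

lemma prob_all_blocks_fail_le:
  fixes d :: "'b :: countable"
  assumes A: "finite A" and W: "finite W"
    and J: "\<And>w. w \<in> W \<Longrightarrow> J w \<subseteq> A" "\<And>w. w \<in> W \<Longrightarrow> card (J w) = m"
    and disj: "disjoint_family_on J W"
    and q: "0 \<le> q" "\<And>w x. w \<in> W \<Longrightarrow> x \<in> J w \<Longrightarrow> q \<le> measure_pmf.prob (p x) (P w x)"
  shows "measure_pmf.prob (Pi_pmf A d p) {f. \<forall>w\<in>W. \<exists>x\<in>J w. f x \<notin> P w x}
    \<le> (1 - q ^ m) ^ card W"
proof -
  let ?prob = "measure_pmf.prob (Pi_pmf A d p)"
  have block: "?prob {f. \<exists>x\<in>J w. f x \<notin> P w x} \<le> 1 - q ^ m" if w: "w \<in> W" for w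
  proof -
    have fin: "finite (J w)"
      using J(1)[OF w] A finite_subset by blast
    have "?prob {f. f x \<in> P w x} = measure_pmf.prob (p x) (P w x)" if "x \<in> J w" for x
    proof -
      have "{f. f x \<in> P w x} = (\<lambda>f. f x) -` P w x"
        by auto
      then have "?prob {f. f x \<in> P w x} = measure_pmf.prob (map_pmf (\<lambda>f. f x) (Pi_pmf A d p)) (P w x)"
        by simp
      then show ?thesis
        using A J(1)[OF w] that by (subst (asm) Pi_pmf_component) auto
    qed
    then have "q ^ m \<le> (\<Prod>x\<in>J w. ?prob {f. f x \<in> P w x})"
      using prod_mono[of "J w" "\<lambda>_. q" "\<lambda>x. ?prob {f. f x \<in> P w x}"] q w J(2) by simp
    also have "\<dots> = ?prob {f. \<forall>x\<in>J w. f x \<in> P w x}"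
      using A fin J(1)[OF w]
      by (intro prob_Pi_pmf_blocks[symmetric, where J = "\<lambda>x. {x}"]) (auto simp: disjoint_family_on_def)
    finally have "1 - ?prob {f. \<forall>x\<in>J w. f x \<in> P w x} \<le> 1 - q ^ m"
      by simp
    moreover have "{f. \<exists>x\<in>J w. f x \<notin> P w x} = UNIV - {f. \<forall>x\<in>J w. f x \<in> P w x}"
      by auto
    ultimately show ?thesis
      by (simp add: measure_pmf.prob_compl[of _ "Pi_pmf A d p", simplified])
  qed
  have "?prob {f. \<forall>w\<in>W. \<exists>x\<in>J w. f x \<notin> P w x} =
      (\<Prod>w\<in>W. ?prob {f. \<exists>x\<in>J w. f x \<notin> P w x})"
    using A W J(1) disj by (intro prob_Pi_pmf_blocks[where J = J]) auto
  also have "\<dots> \<le> (\<Prod>w\<in>W. 1 - q ^ m)"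
    using block by (intro prod_mono) auto
  finally show ?thesis by simp
qed

lemma one_minus_power_le_exp:
  fixes x y :: real
  assumes "x \<le> 1" "y \<le> x * real k"
  shows "(1 - x) ^ k \<le> exp (- y)"
proof -
  have "(1 - x) ^ k \<le> exp (- x) ^ k"
    using assms exp_ge_add_one_self[of "- x"] by (intro power_mono) auto
  also have "\<dots> = exp (- (x * real k))"
    by (simp add: mult.commute flip: exp_of_nat_mult)
  also have "\<dots> \<le> exp (- y)"
    using assms by simp
  finally show ?thesis .
qed

subsection \<open>Choice of the number of hubs\<close>

text \<open>This is the 12th power of y \<le> exp y at y = ln x / 12. The exponent is the one left
  over in the proof of \<open>hub_count\<close>.\<close>

lemma ln_power12_le:
  fixes x :: real
  assumes x: "x \<ge> 1"
  shows "ln x ^ 12 \<le> 12 ^ 12 * x"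
proof -
  have "ln x / 12 \<le> exp (ln x / 12)"
    using exp_ge_add_one_self[of "ln x / 12"] by linarith
  then have "(ln x / 12) ^ 12 \<le> exp (ln x / 12) ^ 12"
    using x by (intro power_mono) auto
  also have "exp (ln x / 12) ^ 12 = x"
    using x by (simp flip: exp_of_nat_mult)
  finally show ?thesis
    by (simp add: power_divide field_simps)
qed

text \<open>With h the integer part of sqrt n, pairs of hubs number at most n. The last two bounds
  make (1 - q)^h and (1 - q^2)^(n - h), for q = p / 7, at most n^(-3). Everything rests on q^2 n
  \<ge> 36 (ln n)^2.\<close>

lemma hub_count:
  fixes n :: nat and p \<gamma> :: real
  assumes n: "n \<ge> 2" and \<gamma>: "\<gamma> > 3" and p: "p \<ge> 7 * (\<gamma> * ln (real n) / real n) powr (1 / 7)"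
    and p1: "p \<le> 1"
  obtains h :: nat where "h \<le> n" "h\<^sup>2 \<le> n" "3 * ln (real n) \<le> p / 7 * real h"
    "3 * ln (real n) \<le> (p / 7)\<^sup>2 * real (n - h)"
proof -
  define L where "L = ln (real n)"
  define q where "q = p / 7"
  define x where "x = \<gamma> * L / real n"
  define h where "h = nat \<lfloor>sqrt (real n)\<rfloor>"
  have n0: "real n > 0"
    using n by simp
  have "ln 2 \<le> L"
    unfolding L_def using n by simp
  then have L: "L \<ge> 1 / 2"
    using ln2_ge_two_thirds by linarith
  have x0: "x > 0"
    using \<gamma> L n0 by (simp add: x_def)
  have q: "x powr (1 / 7) \<le> q"
    using p by (simp add: q_def x_def L_def)
  then have q0: "q \<ge> 0"
    by (rule order_trans[OF powr_ge_zero])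
  have q1: "q \<le> 1 / 7"
    using p1 by (simp add: q_def)
  have "x = (x powr (1 / 7)) ^ 7"
    using x0 by (simp add: powr_powr flip: powr_numeral)
  also have "\<dots> \<le> q ^ 7"
    using q by (intro power_mono) auto
  finally have "\<gamma> * L \<le> q ^ 7 * n"
    using n0 by (simp add: x_def field_simps)
  moreover have "3 * L \<le> \<gamma> * L"
    using \<gamma> L by (intro mult_right_mono) auto
  ultimately have q7: "3 * L \<le> q ^ 7 * n"
    by linarith
  \<comment> \<open>Here p \<le> 1 rules out small n: 823543 is 7^7, and L \<ge> 1/2 gives n \<ge>
    3/2 * 7^7, rounded down to 1235314.\<close>
  have "q ^ 7 * n \<le> (1 / 7) ^ 7 * n"
    using q0 q1 by (intro mult_right_mono power_mono) auto
  then have "3 * L \<le> n / 823543"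
    using q7 by (simp add: power_divide)
  then have n_large: "real n \<ge> 1235314"
    using L by linarith
  \<comment> \<open>Comparing 7th powers, (q^2 n)^7 = (q^7 n)^2 n^5 \<ge> (3L)^2 n^5. If the claim
    failed, n^5 would be at most a constant times L^12, hence n^4 at most a constant that the lower
    bound on n exceeds.\<close>
  have q2: "q\<^sup>2 * n \<ge> 36 * L\<^sup>2"
  proof (rule ccontr)
    assume "\<not> q\<^sup>2 * n \<ge> 36 * L\<^sup>2"
    then have "(q\<^sup>2 * n) ^ 7 \<le> (36 * L\<^sup>2) ^ 7"
      by (intro power_mono) auto
    moreover have "(3 * L)\<^sup>2 * real n ^ 5 \<le> (q ^ 7 * n)\<^sup>2 * real n ^ 5"
      using q7 L by (intro mult_right_mono power_mono) auto
    moreover have "(q ^ 7 * n)\<^sup>2 * real n ^ 5 = (q\<^sup>2 * n) ^ 7"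
      by (simp add: power_mult_distrib flip: power_mult power_add)
    ultimately have "(3 * L)\<^sup>2 * real n ^ 5 \<le> (36 * L\<^sup>2) ^ 7"
      by linarith
    also have "\<dots> = (3 * L)\<^sup>2 * (4 * 36 ^ 6 * L ^ 12)"
      by (simp add: power_mult_distrib flip: power_mult power_add)
    finally have "real n ^ 5 \<le> 4 * 36 ^ 6 * L ^ 12"
      using L by (subst (asm) mult_le_cancel_left_pos) auto
    also have "\<dots> \<le> 4 * 36 ^ 6 * (12 ^ 12 * real n)"
      unfolding L_def using n by (intro mult_left_mono ln_power12_le) auto
    finally have "real n * real n ^ 4 \<le> real n * (4 * 36 ^ 6 * 12 ^ 12)"
      by (simp flip: power_Suc)
    then have "real n ^ 4 \<le> 4 * 36 ^ 6 * 12 ^ 12"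
      using n0 by (subst (asm) mult_le_cancel_left_pos) auto
    moreover have "real n ^ 4 \<ge> 1235314 ^ 4"
      using n_large by (intro power_mono) auto
    ultimately show False
      by simp
  qed
  have "(6 * L)\<^sup>2 \<le> (q * sqrt n)\<^sup>2"
    using q2 by (simp add: power_mult_distrib)
  then have q_sqrt: "6 * L \<le> q * sqrt n"
    using q0 by (intro power2_le_imp_le[of "6 * L"]) auto
  have sqrt2: "2 \<le> sqrt n"
    using n_large by (intro real_le_rsqrt) auto
  \<comment> \<open>Rounding down loses at most a factor 2 since sqrt n \<ge> 2; this turns the 6 in
    \<open>q_sqrt\<close> into the required 3.\<close>
  have h_le: "h \<le> sqrt n" and h_ge: "sqrt n / 2 \<le> h"
    using sqrt2 unfolding h_def by linarith+
  have "(real h)\<^sup>2 \<le> (sqrt n)\<^sup>2"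
    using h_le by (intro power_mono) auto
  then have h2: "h\<^sup>2 \<le> n"
    by (simp flip: of_nat_power)
  have "2 * sqrt n \<le> sqrt n * sqrt n"
    using sqrt2 by (intro mult_right_mono) auto
  then have h_half: "real h \<le> n / 2"
    using h_le by simp
  have "q * (sqrt n / 2) \<le> q * h"
    using h_ge q0 by (intro mult_left_mono) auto
  then have 1: "3 * L \<le> q * h"
    using q_sqrt by simp
  have "3 * L \<le> 36 * (L * L) / 2"
    using mult_right_mono[OF L, of L] L by simp
  also have "\<dots> \<le> q\<^sup>2 * (n / 2)"
    using q2 by (simp add: power2_eq_square)
  also have "\<dots> \<le> q\<^sup>2 * real (n - h)"
    using h_half by (intro mult_left_mono) auto
  finally have 2: "3 * L \<le> q\<^sup>2 * real (n - h)" .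
  show thesis
    using that[of h] 1 2 h2 h_half by (simp add: L_def q_def)
qed

section \<open>Union bound over missing connections\<close>

text \<open>There are three kinds of failure: a non-hub without a block 0 edge to the hubs, one
  without a block 3 edge, and an ordered pair of hubs without a middle vertex. Each kind comprises
  at most n events of probability at most n^(-3). Without failures \<open>hub_spanner\<close>
  applies, and h^2 \<le> n bounds its size by 4n.\<close>

lemma labelled_gnp_linear_spanner:
  assumes n: "n \<ge> 2" and \<gamma>: "\<gamma> > 3" and \<alpha>: "\<alpha> \<ge> 4"
    and p: "p \<ge> 7 * (\<gamma> * ln (real n) / real n) powr (1 / 7)" and p1: "p \<le> 1"
  shows "measure_pmf.prob (labels_pmf n p \<alpha>)
    {f. \<exists>S\<subseteq>time_edges n f. temporally_connected n S \<and> card S \<le> 4 * n} \<ge> 1 - 2 / real n"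
proof -
  obtain h where h: "h \<le> n" "h\<^sup>2 \<le> n" "3 * ln (real n) \<le> p / 7 * real h"
      "3 * ln (real n) \<le> (p / 7)\<^sup>2 * real (n - h)"
    using hub_count[OF n \<gamma> p p1] .
  define H where "H = {..<h}"
  define V where "V = {..<n} - H"
  define G where "G = label_block (\<alpha> div 4)"
  define q where "q = p / 7"
  define \<epsilon> where "\<epsilon> = exp (- (3 * ln (real n)))"
  let ?M = "labels_pmf n p \<alpha>"
  let ?prob = "measure_pmf.prob ?M"
  have p0: "p \<ge> 0"
    using p by (rule order_trans[rotated]) simp
  have q: "0 \<le> q" "q \<le> 1"
    using p0 p1 by (auto simp: q_def)
  have q2: "q\<^sup>2 \<le> 1"
    using q by (simp add: power_le_one)
  have G: "q \<le> measure_pmf.prob (label_pmf p \<alpha>) (G i)" if "i < 4" for i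
    using prob_label_block[OF p0 p1 \<alpha> that] by (simp add: q_def G_def)
  have H: "finite H" "card H = h" "H \<subseteq> {..<n}"
    using h(1) by (auto simp: H_def)
  have V: "finite V" "card V = n - h"
    using H by (auto simp: V_def card_Diff_subset)

  have star: "?prob {f. \<forall>a\<in>H. f {u, a} \<notin> G i} \<le> \<epsilon>" if u: "u \<in> V" and i: "i < 4" for u i
  proof -
    have "?prob {f. \<forall>a\<in>H. \<exists>e\<in>{{u, a}}. f e \<notin> G i} \<le> (1 - q ^ 1) ^ card H"
      unfolding labels_pmf_def using u H q(1) G[OF i]
      by (intro prob_all_blocks_fail_le finite_possible_edges)
        (auto simp: disjoint_family_on_def doubleton_eq_iff pair_in_possible_edges V_def)
    also have "\<dots> \<le> \<epsilon>"
      unfolding \<epsilon>_def using q h(3) by (intro one_minus_power_le_exp) (auto simp: H q_def)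
    finally show ?thesis by simp
  qed
  have mid: "?prob {f. \<forall>w\<in>V. \<not> (f {a, w} \<in> G 1 \<and> f {w, b} \<in> G 2)} \<le> \<epsilon>"
    if ab: "a \<in> H" "b \<in> H" "a \<noteq> b" for a b
  proof -
    define J where "J = (\<lambda>w. {{a, w}, {w, b}})"
    \<comment> \<open>The two edges of \<open>J w\<close> differ because \<open>a\<close> and
      \<open>b\<close> do, so each can be given its own target block.\<close>
    define P where "P = (\<lambda>w e. if e = {a, w} then G 1 else G 2)"
    have "?prob {f. \<forall>w\<in>V. \<exists>e\<in>J w. f e \<notin> P w e} \<le> (1 - q ^ 2) ^ card V"
      unfolding labels_pmf_def
    proof (intro prob_all_blocks_fail_le finite_possible_edges)
      \<comment> \<open>An edge of \<open>J w\<close> has \<open>w\<close> as its only endpoint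
        outside \<open>H\<close>, so it determines \<open>w\<close>.\<close>
      show "disjoint_family_on J V"
        using ab by (auto simp: disjoint_family_on_def J_def V_def doubleton_eq_iff)
      show "card (J w) = 2" if "w \<in> V" for w
        using ab by (auto simp: J_def card_2_iff doubleton_eq_iff)
      show "J w \<subseteq> possible_edges n" if "w \<in> V" for w
        using ab that H by (auto simp: J_def V_def pair_in_possible_edges)
      show "q \<le> measure_pmf.prob (label_pmf p \<alpha>) (P w e)" for w e
        by (simp add: P_def G)
    qed (use V q in auto)
    also have "\<dots> \<le> \<epsilon>"
      unfolding \<epsilon>_def using q2 h(4) by (intro one_minus_power_le_exp) (auto simp: V q_def)
    finally have "?prob {f. \<forall>w\<in>V. \<exists>e\<in>J w. f e \<notin> P w e} \<le> \<epsilon>" .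
    moreover have "(\<exists>e\<in>J w. f e \<notin> P w e) \<longleftrightarrow> \<not> (f {a, w} \<in> G 1 \<and> f {w, b} \<in> G 2)" for w f
      using ab by (auto simp: J_def P_def doubleton_eq_iff)
    ultimately show ?thesis by simp
  qed

  define P where "P = {(a, b). a \<in> H \<and> b \<in> H \<and> a \<noteq> b}"
  have P: "P \<subseteq> H \<times> H" "finite P"
    using H by (auto simp: P_def intro: finite_subset[of _ "H \<times> H"])
  have card_P: "card P \<le> n"
    using card_mono[OF _ P(1)] H h(2) by (simp add: card_cartesian_product power2_eq_square)
  have card_V: "card V \<le> n"
    using V by simp
  have \<epsilon>: "\<epsilon> \<ge> 0" "\<epsilon> * n \<le> 1 / n / n"
    using n by (auto simp: \<epsilon>_def exp_minus exp_of_nat_mult[of 3, simplified] field_simps power3_eq_cube)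
  define B1 where "B1 = (\<Union>u\<in>V. {f. \<forall>a\<in>H. f {u, a} \<notin> G 0})"
  define B2 where "B2 = (\<Union>v\<in>V. {f. \<forall>a\<in>H. f {v, a} \<notin> G 3})"
  define B3 where "B3 = (\<Union>(a, b)\<in>P. {f. \<forall>w\<in>V. \<not> (f {a, w} \<in> G 1 \<and> f {w, b} \<in> G 2)})"
  have union: "?prob (\<Union>x\<in>X. E x) \<le> \<epsilon> * n"
    if "finite X" "card X \<le> n" "\<And>x. x \<in> X \<Longrightarrow> ?prob (E x) \<le> \<epsilon>" for X :: "'x set" and E
  proof -
    have "?prob (\<Union>x\<in>X. E x) \<le> (\<Sum>x\<in>X. ?prob (E x))"
      using that by (intro measure_pmf.finite_measure_subadditive_finite) auto
    also have "\<dots> \<le> card X * \<epsilon>"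
      using that by (intro sum_bounded_above) auto
    also have "\<dots> \<le> n * \<epsilon>"
      using that \<epsilon> by (intro mult_right_mono) auto
    finally show ?thesis by (simp add: mult.commute)
  qed
  have "?prob B1 \<le> \<epsilon> * n" "?prob B2 \<le> \<epsilon> * n"
    unfolding B1_def B2_def using V card_V star by (auto intro!: union)
  moreover have "?prob B3 \<le> \<epsilon> * n"
    unfolding B3_def using P card_P mid by (auto intro!: union simp: P_def)
  moreover have "?prob (B1 \<union> B2 \<union> B3) \<le> ?prob B1 + ?prob B2 + ?prob B3"
    using measure_Un_le[of B1 ?M B2] measure_Un_le[of "B1 \<union> B2" ?M B3] by simp
  ultimately have "?prob (B1 \<union> B2 \<union> B3) \<le> 3 * (1 / n / n)"
    using \<epsilon>(2) by linarith
  \<comment> \<open>From n \<ge> 2 one has 3 / n \<le> 3 / 2 \<le> 2.\<close>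
  also have "\<dots> \<le> 2 / n"
    using n by (simp add: field_simps)
  finally have "1 - 2 / n \<le> ?prob (UNIV - (B1 \<union> B2 \<union> B3))"
    by (simp add: measure_pmf.prob_compl[of _ ?M, simplified])
  also have "\<dots> \<le> ?prob {f. \<exists>S\<subseteq>time_edges n f. temporally_connected n S \<and> card S \<le> 4 * n}"
  proof (intro measure_pmf.finite_measure_mono subsetI CollectI)
    fix f assume f: "f \<in> UNIV - (B1 \<union> B2 \<union> B3)"
    have "\<exists>S\<subseteq>time_edges n f. temporally_connected n S \<and> card S \<le> 2 * n + 2 * (card H)\<^sup>2"
    proof (rule hub_spanner[OF H(3), of f "\<alpha> div 4", folded G_def V_def])
      show "\<exists>a\<in>H. f {u, a} \<in> G 0" if "u \<in> V" for u
        using f that by (auto simp: B1_def)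
      show "\<exists>b\<in>H. f {b, v} \<in> G 3" if "v \<in> V" for v
      proof -
        have "\<exists>b\<in>H. f {v, b} \<in> G 3"
          using f that by (auto simp: B2_def)
        then obtain b where "b \<in> H" "f {v, b} \<in> G 3" ..
        moreover have "{v, b} = {b, v}"
          by auto
        ultimately show ?thesis
          by auto
      qed
      show "\<exists>w\<in>V. f {a, w} \<in> G 1 \<and> f {w, b} \<in> G 2" if "a \<in> H" "b \<in> H" "a \<noteq> b" for a b
        using f that by (auto simp: B3_def P_def)
    qed
    then show "\<exists>S\<subseteq>time_edges n f. temporally_connected n S \<and> card S \<le> 4 * n"
      by (elim ex_forward) (use h(2) H(2) in auto)
  qed simp
  finally show ?thesis .
qed

text \<open>For 0 \<le> p \<le> 1 the quantity n + n p^5 lies between n and 2n. Hence n / 2 \<le>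
  \<open>card S\<close> gives the lower constant 1/4, and \<open>card S\<close> \<le> 4n gives the
  upper constant 4.\<close>

theorem theorem8:
  "\<exists>c C :: real. c > 0 \<and> C > 0 \<and>
     (\<forall>\<gamma>::real. \<gamma> > 3 \<longrightarrow>
       (\<exists>\<gamma>'::real. \<gamma>' \<ge> 1 \<and>
         (\<forall>(n::nat) (p::real) (\<alpha>::nat).
            n \<ge> 2 \<longrightarrow> \<alpha> \<ge> 4 \<longrightarrow>
            p \<ge> 7 * (\<gamma> * ln (real n) / real n) powr (1 / 7) \<longrightarrow> p \<le> 1 \<longrightarrow>
            measure_pmf.prob (labelled_gnp n p \<alpha>)
              {I. (\<exists>S\<subseteq>I. temporally_connected n S \<and>
                     real (card S) \<le> C * (real n + real n * p ^ 5)) \<and>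
                  (\<forall>S\<subseteq>I. temporally_connected n S \<longrightarrow>
                     real (card S) \<ge> c * (real n + real n * p ^ 5))}
            \<ge> 1 - 2 * exp (- \<gamma>' * ln (real n)))))"
proof (rule exI[of _ "1 / 4"], rule exI[of _ 4], intro conjI allI impI, goal_cases)
  case (3 \<gamma>)
  show ?case
  \<comment> \<open>The failure probability 2 / n equals 2 exp (- ln n), so \<gamma>' = 1 serves
    every \<gamma>.\<close>
  proof (rule exI[of _ 1], intro conjI allI impI, goal_cases)
    case (2 n p \<alpha>)
    let ?good = "{I. (\<exists>S\<subseteq>I. temporally_connected n S \<and>
                     real (card S) \<le> 4 * (real n + real n * p ^ 5)) \<and>
                  (\<forall>S\<subseteq>I. temporally_connected n S \<longrightarrow>
                     real (card S) \<ge> 1 / 4 * (real n + real n * p ^ 5))}"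
    have "p \<ge> 0"
      using 2(3) by (rule order_trans[rotated]) simp
    then have p5: "0 \<le> real n * p ^ 5" "real n * p ^ 5 \<le> real n"
      using 2(4) by (auto intro!: mult_left_le power_le_one)
    have "1 - 2 / real n \<le> measure_pmf.prob (labels_pmf n p \<alpha>)
        {f. \<exists>S\<subseteq>time_edges n f. temporally_connected n S \<and> card S \<le> 4 * n}"
      using labelled_gnp_linear_spanner 2 3 by blast
    also have "\<dots> \<le> measure_pmf.prob (labels_pmf n p \<alpha>) (time_edges n -` ?good)"
    proof (rule measure_pmf.finite_measure_mono, rule subsetI, unfold vimage_eq mem_Collect_eq,
        intro conjI allI impI)
      fix f assume "\<exists>S\<subseteq>time_edges n f. temporally_connected n S \<and> card S \<le> 4 * n"
      then obtain S where S: "S \<subseteq> time_edges n f" "temporally_connected n S" "card S \<le> 4 * n"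
        by blast
      then have "real (card S) \<le> 4 * real n"
        by (simp flip: of_nat_mult)
      then have "real (card S) \<le> 4 * (real n + real n * p ^ 5)"
        using p5 by (simp add: distrib_left)
      then show "\<exists>S\<subseteq>time_edges n f. temporally_connected n S \<and>
          real (card S) \<le> 4 * (real n + real n * p ^ 5)"
        using S by blast
    next
      \<comment> \<open>The lower bound holds for every outcome, so it costs no probability.\<close>
      fix f S assume "S \<subseteq> time_edges n f" "temporally_connected n S"
      then have "n \<le> 2 * card S"
        using temporally_connected_card_ge 2(1) by blast
      then show "real (card S) \<ge> 1 / 4 * (real n + real n * p ^ 5)"
        using p5 by (simp add: distrib_left)
    qed simp
    also have "\<dots> = measure_pmf.prob (labelled_gnp n p \<alpha>) ?good"
      using 2(2) by (simp add: labelled_gnp_eq_map)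
    finally show ?case
      using 2(1) by (simp add: exp_minus field_simps)
  qed simp
qed simp_all

end
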